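(* Let $0<\alpha\le\pi/4$ and let $\mathcal N_\alpha$ be the qutrit-to-qutrit channel $\mathcal N_\alpha(\rho)=E_0\rho E_0^\dagger+E_1\rho E_1^\dagger$ with $E_0=\sin\alpha\,|0\rangle\langle1|+|1\rangle\langle2|$ and $E_1=\cos\alpha\,|2\rangle\langle1|+|1\rangle\langle0|$. Then $$M_{0,\mathrm{NS}\cap\mathrm{PPT}}(\mathcal N_\alpha)<\vartheta(\mathcal N_\alpha).$$
   Context: For a channel $\mathcal N$ from $\mathcal L(A')$ to $\mathcal L(B)$ (finite-dimensional, $A\cong A'$), $J_{\mathcal N}=\sum_{i,j}|i\rangle\langle j|_A\otimes\mathcal N(|i\rangle\langle j|_{A'})$ is its Choi matrix and $T_B$ the partial transpose on $B$. The one-shot zero-error capacity (quantified as messages) assisted by no-signalling and PPT-preserving codes is $$M_{0,\mathrm{NS}\cap\mathrm{PPT}}(\mathcal N)=\max\{\operatorname{Tr}S_A:\ 0\le U_{AB}\le S_A\otimes\mathbb 1_B,\ \operatorname{Tr}_AU_{AB}=\mathbb 1_B,\ \operatorname{Tr}J_{\mathcal N}(S_A\otimes\mathbb 1_B-U_{AB})=0,\ 0\le U_{AB}^{T_B}\le S_A\otimes\mathbb 1_B\}.$$ For $\mathcal N(\rho)=\sum_iE_i\rho E_i^\dagger$, the non-commutative graph is $\mathcal S=\operatorname{span}\{E_j^\dagger E_k\}_{j,k}$, and the (naive) Lovász number is $$\vartheta(\mathcal N)=\max\{\|\mathbb 1+T\|_\infty:\ T\in\mathcal S^\perp,\ \mathbb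 1+T\ge0\},$$ where $\mathcal S^\perp$ is the orthogonal complement with respect to the Hilbert-Schmidt inner product and $\|\cdot\|_\infty$ is the operator norm. *)

theory Defs
  imports "HOL-Analysis.Analysis"
begin

text \<open>
  An operator from the space with basis \<open>'c\<close> to the space with basis \<open>'r\<close> is a matrix
  \<open>complex^'c^'r\<close>, indexed as \<open>M $ row $ column\<close>. The composite system \<open>AB\<close> has the basis
  \<open>'a \<times> 'b\<close>, with \<open>A\<close> first.
\<close>

definition ketbra :: "'r \<Rightarrow> 'c \<Rightarrow> complex^'c^'r" where
  "ketbra i j = (\<chi> r c. if r = i \<and> c = j then 1 else 0)"

definition adj :: "complex^'c^'r \<Rightarrow> complex^'r^'c" where
  "adj M = (\<chi> i j. cnj (M $ j $ i))"

definition psd :: "complex^'n^'n \<Rightarrow> bool" where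
  "psd M \<longleftrightarrow> adj M = M \<and> (\<forall>x. 0 \<le> Re (\<Sum>i\<in>UNIV. cnj (x $ i) * (M *v x) $ i))"

definition loewner_le :: "complex^'n^'n \<Rightarrow> complex^'n^'n \<Rightarrow> bool"  (infix "\<preceq>" 50) where
  "A \<preceq> B \<longleftrightarrow> psd (B - A)"

definition tensor :: "complex^'a^'a \<Rightarrow> complex^'b^'b \<Rightarrow> complex^('a \<times> 'b)^('a \<times> 'b)"
    (infixr "\<otimes>\<^sub>m" 75) where
  "X \<otimes>\<^sub>m Y = (\<chi> p q. X $ fst p $ fst q * Y $ snd p $ snd q)"

definition ptrace_A :: "complex^('a::finite \<times> 'b)^('a \<times> 'b) \<Rightarrow> complex^'b^'b" where
  "ptrace_A M = (\<chi> b b'. \<Sum>a\<in>UNIV. M $ (a, b) $ (a, b'))"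

definition ptranspose_B ::
  "complex^('a::finite \<times> 'b::finite)^('a \<times> 'b) \<Rightarrow> complex^('a \<times> 'b)^('a \<times> 'b)" where
  "ptranspose_B M = (\<chi> p q. M $ (fst p, snd q) $ (fst q, snd p))"

definition choi :: "(complex^'a^'a \<Rightarrow> complex^'b^'b) \<Rightarrow> complex^('a \<times> 'b)^('a \<times> 'b)" where
  "choi N = (\<Sum>i\<in>UNIV. \<Sum>j\<in>UNIV. ketbra i j \<otimes>\<^sub>m N (ketbra i j))"

definition ns_ppt_feasible ::
  "(complex^'a^'a \<Rightarrow> complex^'b^'b) \<Rightarrow> complex^'a^'a \<Rightarrow> complex^('a \<times> 'b)^('a \<times> 'b) \<Rightarrow> bool" where
  "ns_ppt_feasible N S U \<longleftrightarrow>
     0 \<preceq> U \<and> U \<preceq> S \<otimes>\<^sub>m mat 1 \<and>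
     ptrace_A U = mat 1 \<and>
     trace (choi N ** (S \<otimes>\<^sub>m mat 1 - U)) = 0 \<and>
     0 \<preceq> ptranspose_B U \<and> ptranspose_B U \<preceq> S \<otimes>\<^sub>m mat 1"

text \<open>
  For a channel the feasible set is compact and nonempty, so the supremum is a maximum. A feasible
  \<open>S\<close> is Hermitian, hence \<open>Re\<close> only casts its trace to \<open>real\<close>.
\<close>

definition M0_NS_PPT :: "(complex^'a^'a \<Rightarrow> complex^'b^'b) \<Rightarrow> real" where
  "M0_NS_PPT N = Sup {Re (trace S) | S U. ns_ppt_feasible N S U}"

definition kraus_map :: "(complex^'a^'b) list \<Rightarrow> complex^'a^'a \<Rightarrow> complex^'b^'b" where
  "kraus_map Es \<rho> = (\<Sum>E\<leftarrow>Es. E ** \<rho> ** adj E)"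

text \<open>
  The library's \<open>span\<close> is the real one and \<open>*s\<close> scales a matrix by row vectors, so the complex
  scalar multiplication of matrices is introduced here to obtain complex spans.
\<close>

definition cscale :: "complex \<Rightarrow> complex^'c^'r \<Rightarrow> complex^'c^'r" where
  "cscale z M = (\<chi> i j. z * M $ i $ j)"

global_interpretation cmat: vector_space "cscale :: complex \<Rightarrow> complex^'c^'r \<Rightarrow> complex^'c^'r"
  by unfold_locales (simp_all add: cscale_def vec_eq_iff algebra_simps)

definition nc_graph :: "(complex^'a^'b) list \<Rightarrow> (complex^'a^'a) set" where
  "nc_graph Es = cmat.span {adj E ** F | E F. E \<in> set Es \<and> F \<in> set Es}"

definition hs_inner :: "complex^'n^'n \<Rightarrow> complex^'n^'n \<Rightarrow> complex" where
  "hs_inner X Y = trace (adj X ** Y)"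

definition hs_orthogonal_comp :: "(complex^'n^'n) set \<Rightarrow> (complex^'n^'n) set" where
  "hs_orthogonal_comp V = {T. \<forall>X\<in>V. hs_inner X T = 0}"

text \<open>
  The graph, and with it the Lovasz number, depends only on the channel \<open>kraus_map Es\<close> and not on
  the chosen Kraus operators. For a channel the graph contains the identity, so every feasible
  \<open>T\<close> is traceless and the supremum is over a compact set, that is, a maximum.
\<close>

definition lovasz_theta :: "(complex^'a^'b) list \<Rightarrow> real" where
  "lovasz_theta Es =
     Sup {onorm ((*v) (mat 1 + T)) | T. T \<in> hs_orthogonal_comp (nc_graph Es) \<and> 0 \<preceq> mat 1 + T}"

text \<open>The elements \<open>0, 1, 2\<close> of the numeral type \<open>3\<close> label the basis of the qutrit.\<close>

definition kraus_E0 :: "real \<Rightarrow> complex^3^3" where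
  "kraus_E0 \<alpha> = sin \<alpha> *\<^sub>R ketbra 0 1 + ketbra 1 2"

definition kraus_E1 :: "real \<Rightarrow> complex^3^3" where
  "kraus_E1 \<alpha> = cos \<alpha> *\<^sub>R ketbra 2 1 + ketbra 1 0"

definition kraus_ops :: "real \<Rightarrow> (complex^3^3) list" where
  "kraus_ops \<alpha> = [kraus_E0 \<alpha>, kraus_E1 \<alpha>]"

end

theory Submission
  imports Defs
begin

text \<open>
  Write \<open>s = sin \<alpha>\<close>, \<open>c = cos \<alpha>\<close>, and \<open>u i j\<close> for the diagonal entries of \<open>U\<close>. The trace condition
  reads \<open>Tr S = s\<^sup>2 u 1 0 + u 2 1 + c\<^sup>2 u 1 2 + u 0 1 + 2 s x + 2 c y\<close>, where \<open>x\<close> and \<open>y\<close> are the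
  real parts of the entries of \<open>U\<close> at \<open>(10, 21)\<close> and \<open>(12, 01)\<close>. Eliminating \<open>u 1 0\<close>, \<open>u 1 2\<close> and
  \<open>u 2 1 + u 0 1\<close> by means of \<open>Tr\<^sub>A U = 1\<close> leaves \<open>2\<close> minus two quadratic forms: that of the partial
  transpose of \<open>U\<close> at \<open>|11> - c |02> - s |20>\<close>, and that of \<open>U\<close> at \<open>s |00> - c |22>\<close> (their
  contributions from the entry at \<open>(00, 22)\<close> cancel). So the capacity is at most \<open>2\<close>. On the other
  hand \<open>1 + T = v v\<^sup>*\<close> with \<open>v = (0, sqrt (1 + 1 / c\<^sup>2), sqrt (1 - s\<^sup>2 / c\<^sup>2))\<close> is feasible for the
  Lovasz number and has norm \<open>3\<close>.
\<close>

subsection \<open>Positive semidefinite matrices\<close>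

lemma quadratic_form_restrict:
  fixes f :: "'n::finite \<Rightarrow> complex"
  assumes "\<And>i. i \<notin> A \<Longrightarrow> f i = 0"
  shows "(\<Sum>i\<in>UNIV. \<Sum>j\<in>UNIV. cnj (f i) * M $ i $ j * f j) =
    (\<Sum>i\<in>A. \<Sum>j\<in>A. cnj (f i) * M $ i $ j * f j)"
proof -
  have "(\<Sum>i\<in>UNIV. \<Sum>j\<in>UNIV. cnj (f i) * M $ i $ j * f j) =
      (\<Sum>i\<in>A. \<Sum>j\<in>UNIV. cnj (f i) * M $ i $ j * f j)"
    by (rule sum.mono_neutral_right) (auto simp: assms)
  also have "\<dots> = (\<Sum>i\<in>A. \<Sum>j\<in>A. cnj (f i) * M $ i $ j * f j)"
    by (intro sum.cong refl sum.mono_neutral_right) (auto simp: assms)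
  finally show ?thesis .
qed

text \<open>Positivity is tested at the vector that is \<open>f\<close> on \<open>A\<close> and zero
  elsewhere, so a test vector with few nonzero entries gives an inequality between few entries of
  \<open>M\<close>.\<close>

lemma psd_quadratic_form:
  assumes "psd M"
  shows "0 \<le> Re (\<Sum>i\<in>A. \<Sum>j\<in>A. cnj (f i) * M $ i $ j * f j)"
proof -
  define x where "x = (\<chi> i. if i \<in> A then f i else 0)"
  have "0 \<le> Re (\<Sum>i\<in>UNIV. cnj (x $ i) * (M *v x) $ i)"
    using assms unfolding psd_def by blast
  also have "(\<Sum>i\<in>UNIV. cnj (x $ i) * (M *v x) $ i) =
      (\<Sum>i\<in>UNIV. \<Sum>j\<in>UNIV. cnj (x $ i) * M $ i $ j * x $ j)"
    by (simp add: matrix_vector_mult_def sum_distrib_left mult_ac)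
  also have "\<dots> = (\<Sum>i\<in>A. \<Sum>j\<in>A. cnj (x $ i) * M $ i $ j * x $ j)"
    by (rule quadratic_form_restrict) (simp add: x_def)
  also have "\<dots> = (\<Sum>i\<in>A. \<Sum>j\<in>A. cnj (f i) * M $ i $ j * f j)"
    by (intro sum.cong refl) (auto simp: x_def)
  finally show ?thesis .
qed

lemma psd_cnj:
  assumes "psd M"
  shows "M $ i $ j = cnj (M $ j $ i)"
  using assms unfolding psd_def adj_def by (metis vec_lambda_beta)

lemma psd_diag_nonneg:
  assumes "psd M"
  shows "0 \<le> Re (M $ i $ i)"
  using psd_quadratic_form[OF assms, of "\<lambda>_. 1" "{i}"] by simp

text \<open>The form at e_i + w e_j is nonnegative. The values w = 1, -1 bound the real part of the
  entry and w = \<i>, -\<i> the imaginary part, each by half of the right-hand side.\<close>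

lemma psd_entry_le:
  assumes "psd M"
  shows "cmod (M $ i $ j) \<le> Re (M $ i $ i) + Re (M $ j $ j)"
proof (cases "i = j")
  case True
  have "Im (M $ i $ i) = 0"
    using psd_cnj[OF assms, of i i] by (metis Reals_cnj_iff complex_is_Real_iff)
  then have "cmod (M $ i $ i) = \<bar>Re (M $ i $ i)\<bar>"
    by (simp add: cmod_def)
  with True psd_diag_nonneg[OF assms, of i] show ?thesis by simp
next
  case False
  note Q = psd_quadratic_form[OF assms, of "(\<lambda>_. 1)(j := w)" "{i, j}" for w]
  note sym = psd_cnj[OF assms, of j i]
  have "\<bar>Re (M $ i $ j)\<bar> \<le> (Re (M $ i $ i) + Re (M $ j $ j)) / 2"
    using False Q[of 1] Q[of "-1"] by (simp add: sym)
  moreover have "\<bar>Im (M $ i $ j)\<bar> \<le> (Re (M $ i $ i) + Re (M $ j $ j)) / 2"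
    using False Q[of \<i>] Q[of "-\<i>"] by (simp add: sym)
  ultimately show ?thesis
    using cmod_le[of "M $ i $ j"] by (smt (verit) field_sum_of_halves)
qed

lemma psd_outer:
  fixes v :: "complex^'n"
  shows "psd (\<chi> i j. v $ i * cnj (v $ j))"
  unfolding psd_def
proof (intro conjI allI)
  show "adj (\<chi> i j. v $ i * cnj (v $ j)) = (\<chi> i j. v $ i * cnj (v $ j))"
    by (simp add: adj_def vec_eq_iff mult.commute)
next
  fix x :: "complex^'n"
  define z where "z = (\<Sum>j\<in>UNIV. cnj (v $ j) * x $ j)"
  have "(\<Sum>i\<in>UNIV. cnj (x $ i) * ((\<chi> i j. v $ i * cnj (v $ j)) *v x) $ i) =
      (\<Sum>i\<in>UNIV. cnj (x $ i) * v $ i * z)"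
    by (simp add: matrix_vector_mult_def z_def sum_distrib_left mult_ac)
  also have "\<dots> = cnj z * z"
    by (simp add: z_def sum_distrib_right mult_ac)
  also have "Re \<dots> = (cmod z)\<^sup>2"
    unfolding cmod_power2 by (simp add: power2_eq_square)
  finally show "0 \<le> Re (\<Sum>i\<in>UNIV. cnj (x $ i) * ((\<chi> i j. v $ i * cnj (v $ j)) *v x) $ i)"
    by simp
qed

lemma norm_matrix_vector_mult_le:
  fixes M :: "complex^'n^'m"
  assumes "\<And>i j. cmod (M $ i $ j) \<le> K"
  shows "norm (M *v x) \<le> real CARD('m) * real CARD('n) * K * norm x"
proof -
  have "norm (M *v x) \<le> (\<Sum>i\<in>UNIV. norm ((M *v x) $ i))"
    unfolding norm_vec_def by (rule L2_set_le_sum) simp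
  also have "\<dots> \<le> (\<Sum>i\<in>(UNIV::'m set). \<Sum>j\<in>(UNIV::'n set). K * norm x)"
  proof (rule sum_mono)
    fix i :: 'm
    have "norm ((M *v x) $ i) \<le> (\<Sum>j\<in>UNIV. norm (M $ i $ j * x $ j))"
      unfolding matrix_vector_mult_def by (simp add: norm_sum)
    also have "\<dots> \<le> (\<Sum>j\<in>(UNIV::'n set). K * norm x)"
      unfolding norm_mult
      by (intro sum_mono mult_mono assms Finite_Cartesian_Product.norm_nth_le norm_ge_zero
          order_trans[OF norm_ge_zero assms])
    finally show "norm ((M *v x) $ i) \<le> (\<Sum>j\<in>(UNIV::'n set). K * norm x)" .
  qed
  finally show ?thesis by simp
qed

lemma bounded_linear_matrix_vector_mult_complex:
  fixes M :: "complex^'n^'m"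
  shows "bounded_linear ((*v) M)"
proof (rule bounded_linear_intro)
  show "M *v (x + y) = M *v x + M *v y" for x y
    by (rule matrix_vector_right_distrib)
  show "M *v (r *\<^sub>R x) = r *\<^sub>R (M *v x)" for r x
    by (simp add: matrix_vector_mult_def vec_eq_iff scaleR_sum_right)
  have "cmod (M $ i $ j) \<le> norm M" for i j
    by (meson Finite_Cartesian_Product.norm_nth_le order_trans)
  from norm_matrix_vector_mult_le[OF this]
  show "norm (M *v x) \<le> norm x * (real CARD('m) * real CARD('n) * norm M)" for x
    by (simp add: mult_ac)
qed

subsection \<open>Choi matrices and graphs of Kraus maps\<close>

text \<open>The Choi matrix is the sum of the rank-one matrices e e^* where e is \<open>E\<close>
  read as a vector of AB, with entry \<open>E $ b $ a\<close> at \<open>(a, b)\<close>.\<close>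

lemma choi_kraus_map_entry:
  "choi (kraus_map Es) $ p $ q =
    (\<Sum>E\<leftarrow>Es. E $ snd p $ fst p * cnj (E $ snd q $ fst q))"
proof -
  have ent: "(\<Sum>E\<leftarrow>Es. E ** ketbra i j ** adj E) $ b $ b' =
      (\<Sum>E\<leftarrow>Es. E $ b $ i * cnj (E $ b' $ j))" for i j b b' and Es :: "(complex^'a^'b) list"
  proof (induction Es)
    case (Cons E Es)
    have "(E ** ketbra i j ** adj E) $ b $ b' = E $ b $ i * cnj (E $ b' $ j)"
      by (simp add: matrix_matrix_mult_def ketbra_def adj_def if_distrib[of "\<lambda>x. _ * x"]
          if_distrib[of "\<lambda>x. x * _"] sum.delta
          flip: if_if_eq_conj cong: if_cong)
    with Cons show ?case by simp
  qed simp
  have "choi (kraus_map Es) $ p $ q = (\<Sum>i\<in>UNIV. \<Sum>j\<in>UNIV.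
      (if fst p = i then if fst q = j then kraus_map Es (ketbra i j) $ snd p $ snd q else 0 else 0))"
    by (auto simp: choi_def tensor_def ketbra_def intro!: sum.cong)
  also have "\<dots> = kraus_map Es (ketbra (fst p) (fst q)) $ snd p $ snd q"
    by (simp add: if_distrib[of "sum _"] sum.If_cases)
  finally show ?thesis
    by (simp add: kraus_map_def ent)
qed

text \<open>By the rank-one decomposition, the trace is the sum of the quadratic forms of
  \<open>W\<close> at the vectorised Kraus operators.\<close>

lemma trace_choi_kraus_map:
  "trace (choi (kraus_map Es) ** W) =
    (\<Sum>E\<leftarrow>Es. \<Sum>p\<in>UNIV. \<Sum>q\<in>UNIV.
      cnj (E $ snd p $ fst p) * W $ p $ q * E $ snd q $ fst q)"
proof -
  have "trace (choi (kraus_map Es) ** W) =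
      (\<Sum>q\<in>UNIV. \<Sum>p\<in>UNIV. choi (kraus_map Es) $ q $ p * W $ p $ q)"
    by (simp add: trace_def matrix_matrix_mult_def)
  also have "\<dots> = (\<Sum>p\<in>UNIV. \<Sum>q\<in>UNIV. choi (kraus_map Es) $ q $ p * W $ p $ q)"
    by (rule sum.swap)
  also have "\<dots> = (\<Sum>E\<leftarrow>Es. \<Sum>p\<in>UNIV. \<Sum>q\<in>UNIV.
      cnj (E $ snd p $ fst p) * W $ p $ q * E $ snd q $ fst q)"
    unfolding choi_kraus_map_entry
    by (induction Es) (simp_all add: algebra_simps sum.distrib)
  finally show ?thesis .
qed

lemma hs_inner_add_left: "hs_inner (X + Y) T = hs_inner X T + hs_inner Y T"
  by (simp add: hs_inner_def trace_def matrix_matrix_mult_def adj_def distrib_right sum.distrib)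

lemma hs_inner_cscale_left: "hs_inner (cscale z X) T = cnj z * hs_inner X T"
  by (simp add: hs_inner_def trace_def matrix_matrix_mult_def adj_def cscale_def
      sum_distrib_left mult_ac)

text \<open>\<open>hs_inner\<close> is conjugate-linear in its first argument, so orthogonality to
  the generators passes to their complex span.\<close>

lemma hs_orthogonal_comp_nc_graph:
  "T \<in> hs_orthogonal_comp (nc_graph Es) \<longleftrightarrow>
    (\<forall>E\<in>set Es. \<forall>F\<in>set Es. hs_inner (adj E ** F) T = 0)"
proof
  assume "T \<in> hs_orthogonal_comp (nc_graph Es)"
  then show "\<forall>E\<in>set Es. \<forall>F\<in>set Es. hs_inner (adj E ** F) T = 0"
    unfolding hs_orthogonal_comp_def nc_graph_def by (blast intro: cmat.span_base)
next
  assume *: "\<forall>E\<in>set Es. \<forall>F\<in>set Es. hs_inner (adj E ** F) T = 0"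
  have zero: "hs_inner 0 T = 0"
    by (simp add: hs_inner_def trace_def matrix_matrix_mult_def adj_def)
  have "hs_inner X T = 0" if "X \<in> nc_graph Es" for X
    using that unfolding nc_graph_def
    by (induction rule: cmat.span_induct_alt)
      (use * zero in \<open>auto simp: hs_inner_add_left hs_inner_cscale_left\<close>)
  then show "T \<in> hs_orthogonal_comp (nc_graph Es)"
    unfolding hs_orthogonal_comp_def by blast
qed

subsection \<open>The channel\<close>

lemma UNIV_3_from_0: "(UNIV :: 3 set) = {0, 1, 2}"
proof -
  have "(3::3) = 0" by simp
  then show ?thesis using UNIV_3 by auto
qed

lemma sum_UNIV_3: "(\<Sum>i\<in>(UNIV :: 3 set). f i) = f 0 + (f 1 + f 2)"
  unfolding UNIV_3_from_0 by simp

lemma kraus_E0_entry: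
  "kraus_E0 \<alpha> $ b $ a =
    (if a = 1 \<and> b = 0 then of_real (sin \<alpha>) else if a = 2 \<and> b = 1 then 1 else 0)"
  unfolding kraus_E0_def ketbra_def by (auto simp: of_real_def)

lemma kraus_E1_entry:
  "kraus_E1 \<alpha> $ b $ a =
    (if a = 1 \<and> b = 2 then of_real (cos \<alpha>) else if a = 0 \<and> b = 1 then 1 else 0)"
  unfolding kraus_E1_def ketbra_def by (auto simp: of_real_def)

section \<open>Upper bound on the capacity\<close>

lemma trace_le_2_if_feasible:
  assumes "ns_ppt_feasible (kraus_map (kraus_ops \<alpha>)) S U"
  shows "Re (trace S) \<le> 2"
proof -
  define s c where "s = sin \<alpha>" and "c = cos \<alpha>"
  have sc: "s * s + c * c = 1"
    by (simp add: s_def c_def flip: power2_eq_square)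
  have psdU: "psd U" and psdT: "psd (ptranspose_B U)" and pt: "ptrace_A U = mat 1"
    and tr: "trace (choi (kraus_map (kraus_ops \<alpha>)) ** (S \<otimes>\<^sub>m mat 1 - U)) = 0"
    using assms by (auto simp: ns_ppt_feasible_def loewner_le_def)
  have marginal: "Re (U $ (0, b) $ (0, b)) + (Re (U $ (1, b) $ (1, b)) + Re (U $ (2, b) $ (2, b))) = 1"
    for b
  proof -
    have "Re (ptrace_A U $ b $ b) = 1"
      by (simp add: pt mat_def)
    then show ?thesis
      by (simp add: ptrace_A_def sum_UNIV_3)
  qed
  have pos: "0 \<le> s * s * Re (U $ (0, 0) $ (0, 0)) + c * c * Re (U $ (2, 2) $ (2, 2))
      - 2 * (s * c) * Re (U $ (0, 0) $ (2, 2))"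
    using psd_quadratic_form[OF psdU, of
        "(\<lambda>_. 0)((0, 0) := of_real s, (2, 2) := - of_real c)" "{(0, 0), (2, 2)}"]
    by (simp add: psd_cnj[OF psdU, of "(2, 2)" "(0, 0)"] algebra_simps)
  \<comment> \<open>The partial transpose moves the entries of \<open>U\<close> at (12, 01), (10,
    21) and (00, 22) to (11, 02), (11, 20) and (02, 20). Hence a single test vector meets both cross
    terms of the trace condition.\<close>
  have ppt: "0 \<le> Re (U $ (1, 1) $ (1, 1)) + c * c * Re (U $ (0, 2) $ (0, 2))
      + s * s * Re (U $ (2, 0) $ (2, 0)) - 2 * c * Re (U $ (1, 2) $ (0, 1))
      - 2 * s * Re (U $ (1, 0) $ (2, 1)) + 2 * (s * c) * Re (U $ (0, 0) $ (2, 2))"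
    using psd_quadratic_form[OF psdT, of
        "(\<lambda>_. 0)((1, 1) := 1, (0, 2) := - of_real c, (2, 0) := - of_real s)"
        "{(1, 1), (0, 2), (2, 0)}"]
    by (simp add: ptranspose_B_def psd_cnj[OF psdU, of "(2, 2)" "(0, 0)"]
        psd_cnj[OF psdU, of "(0, 1)" "(1, 2)"] psd_cnj[OF psdU, of "(2, 1)" "(1, 0)"] algebra_simps)
  \<comment> \<open>\<open>?A\<close> and \<open>?B\<close> are the supports of the vectorised Kraus
    operators. The two indices in each differ in their B part, so
    \<open>S \<otimes>\<^sub>m mat 1\<close> contributes to the diagonal terms only.\<close>
  let ?W = "S \<otimes>\<^sub>m mat 1 - U" and ?A = "{(1, 0), (2, 1)} :: (3 \<times> 3) set"
    and ?B = "{(1, 2), (0, 1)} :: (3 \<times> 3) set"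
  note E0 = kraus_E0_entry[of \<alpha>, folded s_def] and E1 = kraus_E1_entry[of \<alpha>, folded c_def]
  have "trace (choi (kraus_map (kraus_ops \<alpha>)) ** ?W) =
      (\<Sum>p\<in>?A. \<Sum>q\<in>?A. cnj (kraus_E0 \<alpha> $ snd p $ fst p) * ?W $ p $ q * kraus_E0 \<alpha> $ snd q $ fst q) +
      (\<Sum>p\<in>?B. \<Sum>q\<in>?B. cnj (kraus_E1 \<alpha> $ snd p $ fst p) * ?W $ p $ q * kraus_E1 \<alpha> $ snd q $ fst q)"
    by (subst (1 2) quadratic_form_restrict[symmetric])
      (auto simp: E0 E1 trace_choi_kraus_map kraus_ops_def)
  from arg_cong[OF this, of Re] have "Re (trace (choi (kraus_map (kraus_ops \<alpha>)) ** ?W)) =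
      s * s * Re (S $ 1 $ 1 - U $ (1, 0) $ (1, 0)) + Re (S $ 2 $ 2 - U $ (2, 1) $ (2, 1))
      + c * c * Re (S $ 1 $ 1 - U $ (1, 2) $ (1, 2)) + Re (S $ 0 $ 0 - U $ (0, 1) $ (0, 1))
      - 2 * s * Re (U $ (1, 0) $ (2, 1)) - 2 * c * Re (U $ (1, 2) $ (0, 1))"
    by (simp add: E0 E1 tensor_def mat_def psd_cnj[OF psdU, of "(0, 1)" "(1, 2)"]
        psd_cnj[OF psdU, of "(2, 1)" "(1, 0)"] algebra_simps)
  \<comment> \<open>The two coefficients of \<open>S $ 1 $ 1\<close> add up to 1, so the terms in
    \<open>S\<close> form its trace.\<close>
  with tr have "Re (trace S) = s * s * Re (U $ (1, 0) $ (1, 0)) + Re (U $ (2, 1) $ (2, 1))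
      + c * c * Re (U $ (1, 2) $ (1, 2)) + Re (U $ (0, 1) $ (0, 1))
      + 2 * s * Re (U $ (1, 0) $ (2, 1)) + 2 * c * Re (U $ (1, 2) $ (0, 1))"
    using arg_cong[OF sc, of "\<lambda>t. t * Re (S $ 1 $ 1)"]
    by (simp add: trace_def sum_UNIV_3 algebra_simps)
  with pos ppt sc marginal[of 1] arg_cong[OF marginal[of 0], of "\<lambda>t. s * s * t"]
    arg_cong[OF marginal[of 2], of "\<lambda>t. c * c * t"]
  show ?thesis
    by (simp add: algebra_simps)
qed

text \<open>A code for a single message, in which \<open>U\<close> equals
  \<open>S \<otimes>\<^sub>m mat 1\<close>. It shows that the set under \<open>Sup\<close> is
  nonempty, as \<open>cSup_least\<close> demands.\<close>

lemma ns_ppt_feasible_ketbra: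
  fixes N :: "complex^'a^'a \<Rightarrow> complex^'b^'b"
  shows "ns_ppt_feasible N (ketbra a a) (ketbra a a \<otimes>\<^sub>m mat 1)"
proof -
  let ?U = "ketbra a a \<otimes>\<^sub>m mat 1 :: complex^('a \<times> 'b)^('a \<times> 'b)"
  have "ptranspose_B ?U = ?U"
    by (auto simp: ptranspose_B_def tensor_def mat_def vec_eq_iff)
  moreover have "ptrace_A ?U = mat 1"
    by (simp add: ptrace_A_def tensor_def ketbra_def vec_eq_iff sum.delta flip: sum_distrib_right)
  moreover have "psd ?U"
    unfolding psd_def
  proof (intro conjI allI)
    show "adj ?U = ?U"
      by (auto simp: adj_def tensor_def ketbra_def mat_def vec_eq_iff)
  next
    fix x :: "complex^('a \<times> 'b)"
    have "?U $ p $ q = (if q = p then if fst p = a then 1 else 0 else 0)" for p q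
      by (auto simp: tensor_def ketbra_def mat_def prod_eq_iff)
    then have "(?U *v x) $ p = (if fst p = a then x $ p else 0)" for p
      by (simp add: matrix_vector_mult_def if_distrib[of "\<lambda>t. t * _"] cong: if_cong)
    then show "0 \<le> Re (\<Sum>p\<in>UNIV. cnj (x $ p) * (?U *v x) $ p)"
      by (auto intro!: sum_nonneg)
  qed
  moreover have "psd (0 :: complex^('a \<times> 'b)^('a \<times> 'b))"
    by (simp add: psd_def adj_def vec_eq_iff)
  ultimately show ?thesis
    by (simp add: ns_ppt_feasible_def loewner_le_def trace_def)
qed

lemma M0_NS_PPT_le_2: "M0_NS_PPT (kraus_map (kraus_ops \<alpha>)) \<le> 2"
  unfolding M0_NS_PPT_def
  by (rule cSup_least) (use ns_ppt_feasible_ketbra trace_le_2_if_feasible in blast)+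

section \<open>Lower bound on the Lovasz number\<close>

text \<open>The products of the Kraus operators are s^2 |1><1| + |2><2|, c^2 |1><1| + |0><0|, |2><0|
  and |0><2|, with s and c the sine and cosine of \<alpha>.\<close>

lemma kraus_graph_orthogonal_iff:
  "T \<in> hs_orthogonal_comp (nc_graph (kraus_ops \<alpha>)) \<longleftrightarrow>
    of_real ((sin \<alpha>)\<^sup>2) * T $ 1 $ 1 + T $ 2 $ 2 = 0 \<and>
    of_real ((cos \<alpha>)\<^sup>2) * T $ 1 $ 1 + T $ 0 $ 0 = 0 \<and> T $ 0 $ 2 = 0 \<and> T $ 2 $ 0 = 0"
  unfolding hs_orthogonal_comp_nc_graph
  by (auto simp: kraus_ops_def kraus_E0_entry kraus_E1_entry hs_inner_def trace_def adj_def
      matrix_matrix_mult_def sum_UNIV_3 power2_eq_square add.commute)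

lemma lovasz_theta_ge_3:
  assumes "\<bar>sin \<alpha>\<bar> \<le> cos \<alpha>"
  shows "3 \<le> lovasz_theta (kraus_ops \<alpha>)"
proof -
  let ?F = "{T. T \<in> hs_orthogonal_comp (nc_graph (kraus_ops \<alpha>)) \<and> 0 \<preceq> mat 1 + T}"
  \<comment> \<open>\<open>t\<close> is the entry of T at (1, 1). With this value orthogonality
    makes the diagonal of 1 + T equal to 0, 1 + t, 2 - t.\<close>
  define t where "t = 1 / (cos \<alpha>)\<^sup>2"
  have "cos \<alpha> \<noteq> 0"
    using assms sin_cos_squared_add[of \<alpha>] by fastforce
  then have ct: "(cos \<alpha>)\<^sup>2 * t = 1" and "0 \<le> t"
    by (simp_all add: t_def)
  have st: "(sin \<alpha>)\<^sup>2 * t = t - 1"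
    using ct by (simp add: sin_squared_eq algebra_simps)
  have "(sin \<alpha>)\<^sup>2 \<le> (cos \<alpha>)\<^sup>2"
    using assms by (simp add: abs_le_square_iff[symmetric])
  \<comment> \<open>Here the assumption on \<alpha> enters: it makes 2 - t nonnegative, hence the
    square of an entry of \<open>v\<close>.\<close>
  with ct st \<open>0 \<le> t\<close> have "t \<le> 2"
    using mult_right_mono[of "(sin \<alpha>)\<^sup>2" "(cos \<alpha>)\<^sup>2" t] by simp
  define v :: "complex^3" where
    "v = (\<chi> i. if i = 0 then 0 else if i = 1 then of_real (sqrt (1 + t)) else of_real (sqrt (2 - t)))"
  define V :: "complex^3^3" where "V = (\<chi> i j. v $ i * cnj (v $ j))"
  have sq: "complex_of_real (sqrt (1 + t)) * of_real (sqrt (1 + t)) = 1 + of_real t"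
    "complex_of_real (sqrt (2 - t)) * of_real (sqrt (2 - t)) = 2 - of_real t"
    using \<open>0 \<le> t\<close> \<open>t \<le> 2\<close> by (simp_all flip: of_real_mult)
  have ct': "complex_of_real ((cos \<alpha>)\<^sup>2) * of_real t = 1"
    using ct by (metis of_real_1 of_real_mult)
  have st': "complex_of_real ((sin \<alpha>)\<^sup>2) * of_real t = of_real t - 1"
    using st by (metis of_real_1 of_real_diff of_real_mult)
  have "V - mat 1 \<in> ?F"
  proof -
    have "psd V"
      unfolding V_def by (rule psd_outer)
    then show ?thesis
      using ct' st' by (simp add: kraus_graph_orthogonal_iff loewner_le_def V_def v_def mat_def sq)
  qed
  \<comment> \<open>The supremum is real, so a member bounds it from below only if the set is
    bounded. The two diagonal conditions add up to Tr T = 0. Hence \<open>M\<close> has trace 3, its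
    diagonal entries are at most 3 and all entries at most 6 in modulus.\<close>
  moreover have "bdd_above ((\<lambda>T. onorm ((*v) (mat 1 + T))) ` ?F)"
  proof (rule bdd_aboveI2)
    fix T assume "T \<in> ?F"
    define M where "M = mat 1 + T"
    from \<open>T \<in> ?F\<close> have "psd M"
      and T: "of_real ((sin \<alpha>)\<^sup>2) * T $ 1 $ 1 + T $ 2 $ 2 = 0"
        "of_real ((cos \<alpha>)\<^sup>2) * T $ 1 $ 1 + T $ 0 $ 0 = 0"
      by (auto simp: kraus_graph_orthogonal_iff loewner_le_def M_def)
    have "of_real ((sin \<alpha>)\<^sup>2 + (cos \<alpha>)\<^sup>2) * T $ 1 $ 1 + T $ 0 $ 0 + T $ 2 $ 2 = 0"
      using arg_cong2[of _ _ _ _ "(+)", OF T] unfolding of_real_add by (simp add: algebra_simps)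
    then have "T $ 1 $ 1 + T $ 0 $ 0 + T $ 2 $ 2 = 0"
      unfolding sin_cos_squared_add by simp
    then have "Re (M $ 0 $ 0) + Re (M $ 1 $ 1) + Re (M $ 2 $ 2) = 3"
      by (simp add: M_def mat_def complex_eq_iff)
    then have "Re (M $ i $ i) \<le> 3" for i :: 3
      using psd_diag_nonneg[OF \<open>psd M\<close>, of 0] psd_diag_nonneg[OF \<open>psd M\<close>, of 1]
        psd_diag_nonneg[OF \<open>psd M\<close>, of 2] UNIV_I[of i] unfolding UNIV_3_from_0 by auto
    then have "cmod (M $ i $ j) \<le> 6" for i j
      using psd_entry_le[OF \<open>psd M\<close>, of i j] by (smt (verit))
    from norm_matrix_vector_mult_le[of M, OF this]
    show "onorm ((*v) (mat 1 + T)) \<le> real CARD(3) * real CARD(3) * 6"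
      unfolding M_def[symmetric] by (rule onorm_le)
  qed
  ultimately have "onorm ((*v) V) \<le> lovasz_theta (kraus_ops \<alpha>)"
    unfolding lovasz_theta_def setcompr_eq_image
    using cSUP_upper[of "V - mat 1" ?F "\<lambda>T. onorm ((*v) (mat 1 + T))"] by simp
  moreover have "3 \<le> onorm ((*v) V)"
  proof -
    \<comment> \<open>The squared norm (1 + t) + (2 - t) of \<open>v\<close> is the eigenvalue of
      \<open>V\<close> at \<open>v\<close>.\<close>
    have "cnj (v $ 0) * v $ 0 + (cnj (v $ 1) * v $ 1 + cnj (v $ 2) * v $ 2) = 3"
      by (simp add: v_def sq)
    then have "V *v v = 3 *\<^sub>R v"
      by (simp add: V_def matrix_vector_mult_def vec_eq_iff sum_UNIV_3 scaleR_conv_of_real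
          mult.assoc flip: distrib_left)
    then have "3 * norm v \<le> onorm ((*v) V) * norm v"
      using onorm[OF bounded_linear_matrix_vector_mult_complex, of V v] by simp
    moreover have "v $ 1 \<noteq> 0"
      using \<open>0 \<le> t\<close> by (simp add: v_def)
    then have "0 < norm v" by auto
    ultimately show ?thesis by simp
  qed
  ultimately show ?thesis by linarith
qed

theorem proposition18:
  fixes \<alpha> :: real
  assumes "0 < \<alpha>" and "\<alpha> \<le> pi / 4"
  shows "M0_NS_PPT (kraus_map (kraus_ops \<alpha>)) < lovasz_theta (kraus_ops \<alpha>)"
proof -
  have "sin \<alpha> \<le> sin (pi / 4)" "cos (pi / 4) \<le> cos \<alpha>" "0 \<le> sin \<alpha>"
    using assms by (auto intro!: sin_monotone_2pi_le cos_monotone_0_pi_le sin_ge_zero)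
  then have "\<bar>sin \<alpha>\<bar> \<le> cos \<alpha>"
    by (simp add: sin_45 cos_45)
  then show ?thesis
    using lovasz_theta_ge_3[of \<alpha>] M0_NS_PPT_le_2[of \<alpha>] by linarith
qed

end
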